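(* Let $T$ be a string of length $n \geq 3$ with $\mathsf{e}(T) \geq 3$, and let $a$ be any character. Then $\mathsf{e}(aT) - \mathsf{e}(T) \leq \mathsf{e}(T) - 1$. Equivalently, for $n \geq 3$ and $\mathsf{e} \geq 3$, the worst-case additive sensitivity of the CDAWG size under left-end insertion is at most $\mathsf{e}-1$.
   Context: Strings are finite sequences of characters from an alphabet $\Sigma$; $\varepsilon$ is the empty string, $|T|$ is the length of $T$, $T[i]$ its $i$-th character and $T[i..j]=T[i]\cdots T[j]$. For a string $T$, $\mathrm{Substr}(T)$, $\mathrm{Prefix}(T)$, $\mathrm{Suffix}(T)$ denote its sets of substrings, prefixes and suffixes (all containing $\varepsilon$). A substring $u$ of $T$ is left-maximal in $T$ if $u$ is a prefix of $T$ or there are distinct characters $c \neq d$ with $cu, du \in \mathrm{Substr}(T)$; it is right-maximal in $T$ if $u$ is a suffix of $T$ or there are distinct characters $c\neq d$ with $uc, ud \in \mathrm{Substr}(T)$. $\mathsf{M}(T)$ is the set of substrings of $T$ that are both left- and right-maximal (it contains $\varepsilon$ and $T$). The compact directed acyclic word graph $\mathrm{CDAWG}(T)$ has exactly one node for each element of $\mathsf{M}(T)$, and the outgoing edges of the node $x \in \mathsf{M}(T)$ are in bijection with the characters $c$ such that $xc \in \mathrm{Substr}(T)$. For any string $w$, let $d_T(w)$ be the number of distinct characters $c$ with $wc \in \mathrm{Substr}(T)$ (for $x\in\mathsf{M}(T)$ this is the out-degree of $x$ in $\mathrm{CDAWG}(T)$). The size of the CDAWG is its number of edges, $\mathsf{e}(T)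 = \sum_{x \in \mathsf{M}(T)} d_T(x)$. *)

theory Defs
  imports "HOL-Library.Sublist" "HOL-Library.Extended_Real"
begin

definition left_maximal :: "'a list \<Rightarrow> 'a list \<Rightarrow> bool" where
  "left_maximal T u \<longleftrightarrow> sublist u T \<and>
     (prefix u T \<or> (\<exists>c d. c \<noteq> d \<and> sublist (c # u) T \<and> sublist (d # u) T))"

definition right_maximal :: "'a list \<Rightarrow> 'a list \<Rightarrow> bool" where
  "right_maximal T u \<longleftrightarrow> sublist u T \<and>
     (suffix u T \<or> (\<exists>c d. c \<noteq> d \<and> sublist (u @ [c]) T \<and> sublist (u @ [d]) T))"

definition max_substrings :: "'a list \<Rightarrow> 'a list set" where
  "max_substrings T = {u. left_maximal T u \<and> right_maximal T u}"

definition out_degree :: "'a list \<Rightarrow> 'a list \<Rightarrow> nat" where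
  "out_degree T w = card {c. sublist (w @ [c]) T}"

definition cdawg_size :: "'a list \<Rightarrow> nat" where
  "cdawg_size T = (\<Sum>x \<in> max_substrings T. out_degree T x)"

text \<open>The worst case is taken over all strings of length \<open>n\<close> over the alphabet \<open>\<Sigma>\<close> whose CDAWG has
  size \<open>e\<close>. The supremum is formed in the extended reals, so that it is \<open>- \<infinity>\<close> if there is no such
  string (or no character to insert).\<close>

definition left_insertion_sensitivity :: "'a set \<Rightarrow> nat \<Rightarrow> nat \<Rightarrow> ereal" where
  "left_insertion_sensitivity \<Sigma> n e =
     (SUP (T, a) \<in> {T \<in> lists \<Sigma>. length T = n \<and> cdawg_size T = e} \<times> \<Sigma>.
        ereal (real (cdawg_size (a # T)) - real (cdawg_size T)))"

text \<open>The two finiteness facts ensure that neither \<^const>\<open>sum\<close> nor \<^const>\<open>card\<close> takes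
  its default value above.\<close>

lemma finite_max_substrings: "finite (max_substrings T)"
  by (rule finite_subset[of _ "set (sublists T)"])
     (auto simp: max_substrings_def left_maximal_def)

lemma finite_right_extensions: "finite {c. sublist (w @ [c]) T}"
  by (rule finite_subset[of _ "set T"]) (auto dest: set_mono_sublist)

end

theory Submission
  imports Defs
begin

text \<open>Let \<open>p\<close> be the longest prefix of \<open>aT\<close> that occurs in \<open>T\<close>. Prepending \<open>a\<close> changes no
  out-degree of a substring of \<open>T\<close> except that of \<open>p\<close>, which grows by one, and the only new nodes
  of positive out-degree are prefixes of \<open>p\<close>: those right-maximal but not left-maximal in \<open>T\<close>, and
  possibly \<open>p\<close> itself. Extending such a prefix \<open>w\<close> to the left as long as the extension is forced
  gives a nonempty node of \<open>T\<close> with the same out-degree. This closure is injective: if \<open>w\<close> is a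
  proper prefix of \<open>w'\<close> and both have the same closure, then the leftmost occurrence of \<open>w\<close> would
  not be leftmost. So the new prefixes cost at most \<open>e(T) - \<sigma>\<close>, where \<open>\<sigma>\<close> is the out-degree of the
  empty string, i.e. the number of distinct characters of \<open>T\<close>.

  Hence \<open>e(aT) \<le> 2 e(T) - \<sigma> + 1\<close> if \<open>p\<close> is right-maximal in \<open>T\<close>, and \<open>e(aT) \<le> 2 e(T) - \<sigma> + 2\<close>
  otherwise. If \<open>\<sigma> = 1\<close>, every substring is already a node. What remains is \<open>\<sigma> = 2\<close> with \<open>p = au\<close> not
  right-maximal: the shortest nonempty border of \<open>u\<close> (possibly \<open>u\<close> itself) is a node of \<open>T\<close> of
  out-degree at least \<open>2\<close> that is not the closure of any new prefix, and if \<open>u\<close> is empty there are no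
  new prefixes besides \<open>p\<close>.\<close>

section \<open>Forced left extensions and the left closure of a substring\<close>

definition forced_left_extension :: "'a list \<Rightarrow> 'a list \<Rightarrow> 'a list \<Rightarrow> bool" where
  "forced_left_extension T w \<alpha> \<longleftrightarrow> (\<forall>s t. T = s @ w @ t \<longrightarrow> suffix \<alpha> s)"

lemma forced_left_extensionE:
  assumes "forced_left_extension T w \<alpha>" "T = s @ w @ t"
  obtains s' where "s = s' @ \<alpha>"
  using assms unfolding forced_left_extension_def suffix_def by blast

lemma forced_left_extension_sublist:
  assumes "forced_left_extension T w \<alpha>" "sublist (w @ y) T"
  shows "sublist (\<alpha> @ w @ y) T"
proof -
  from assms(2) obtain s t where T: "T = s @ w @ (y @ t)" by (auto simp: sublist_def)
  with assms(1) obtain s' where "s = s' @ \<alpha>" by (rule forced_left_extensionE)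
  with T show ?thesis by (auto simp: sublist_def)
qed

lemma forced_left_extension_suffix:
  assumes "forced_left_extension T w \<alpha>" "suffix w T"
  shows "suffix (\<alpha> @ w) T"
proof -
  from assms(2) obtain s where T: "T = s @ w @ []" by (auto simp: suffix_def)
  with assms(1) obtain s' where "s = s' @ \<alpha>" by (rule forced_left_extensionE)
  with T show ?thesis by (auto simp: suffix_def)
qed

lemma sublist_appendD2: "sublist (x @ y) T \<Longrightarrow> sublist y T"
  by (rule sublist_order.order.trans[OF suffix_imp_sublist]) (auto simp: suffix_def)

text \<open>A longest forced extension works; since \<open>w\<close> occurs, lengths are bounded by
  that of \<open>T\<close>. If \<open>\<alpha> @ w\<close> were not left-maximal, it would always be
  preceded by one and the same character, which could be added to \<open>\<alpha>\<close>.\<close>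

lemma left_maximal_forced_extension_exists:
  assumes "sublist w T"
  shows "\<exists>\<alpha>. forced_left_extension T w \<alpha> \<and> left_maximal T (\<alpha> @ w)"
proof -
  let ?P = "\<lambda>\<alpha>. forced_left_extension T w \<alpha>"
  have sub: "sublist (\<alpha> @ w) T" if "?P \<alpha>" for \<alpha>
    using forced_left_extension_sublist[OF that, of "[]"] assms by simp
  have bound: "length \<alpha> \<le> length T" if "?P \<alpha>" for \<alpha>
    using sublist_length_le[OF sub[OF that]] by simp
  have "?P []" by (simp add: forced_left_extension_def)
  moreover have "\<forall>\<alpha>. ?P \<alpha> \<longrightarrow> length \<alpha> < Suc (length T)"
    using bound less_Suc_eq_le by blast
  ultimately have "\<exists>\<alpha>. ?P \<alpha> \<and> (\<forall>\<beta>. ?P \<beta> \<longrightarrow> length \<beta> \<le> length \<alpha>)"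
    by (rule ex_has_greatest_nat)
  then obtain \<alpha> where \<alpha>: "?P \<alpha>" and longest: "\<And>\<beta>. ?P \<beta> \<Longrightarrow> length \<beta> \<le> length \<alpha>"
    by blast
  have "left_maximal T (\<alpha> @ w)"
  proof (rule ccontr)
    assume "\<not> left_maximal T (\<alpha> @ w)"
    then have notpre: "\<not> prefix (\<alpha> @ w) T"
      and unique: "\<And>c d. sublist (c # \<alpha> @ w) T \<Longrightarrow> sublist (d # \<alpha> @ w) T \<Longrightarrow> c = d"
      using sub[OF \<alpha>] by (auto simp: left_maximal_def)
    have preceded: "\<exists>s' c. s = s' @ c # \<alpha> \<and> sublist (c # \<alpha> @ w) T" if T: "T = s @ w @ t" for s t
    proof -
      from \<alpha> T obtain s1 where s1: "s = s1 @ \<alpha>" by (rule forced_left_extensionE)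
      with T notpre have "s1 \<noteq> []" by (auto simp: prefix_def)
      then obtain s' c where "s1 = s' @ [c]" by (meson rev_exhaust)
      with s1 T show ?thesis by (auto simp: sublist_def)
    qed
    from assms obtain s t where "T = s @ w @ t" by (auto simp: sublist_def)
    from preceded[OF this] obtain c where c: "sublist (c # \<alpha> @ w) T" by blast
    have "?P (c # \<alpha>)"
      unfolding forced_left_extension_def suffix_def
      using preceded unique[OF c] by blast
    from longest[OF this] show False by simp
  qed
  with \<alpha> show ?thesis by blast
qed

text \<open>\<open>SOME\<close> spares a uniqueness proof: the properties collected in
  \<open>left_closureE\<close> suffice.\<close>

definition left_closure :: "'a list \<Rightarrow> 'a list \<Rightarrow> 'a list" where
  "left_closure T w = (SOME x. \<exists>\<alpha>. x = \<alpha> @ w \<and> forced_left_extension T w \<alpha> \<and> left_maximal T x)"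

lemma left_closureE:
  assumes "sublist w T"
  obtains \<alpha> where "left_closure T w = \<alpha> @ w" "forced_left_extension T w \<alpha>"
    "left_maximal T (left_closure T w)"
proof -
  have "\<exists>\<alpha>. left_closure T w = \<alpha> @ w \<and> forced_left_extension T w \<alpha> \<and>
      left_maximal T (left_closure T w)"
    unfolding left_closure_def
    by (rule someI_ex) (use left_maximal_forced_extension_exists[OF assms] in blast)
  with that show ?thesis by blast
qed

text \<open>Every occurrence of \<open>w\<close> extends to one of its closure, so both have the
  same right contexts.\<close>

lemma sublist_left_closure_append_iff:
  assumes "sublist w T"
  shows "sublist (left_closure T w @ y) T \<longleftrightarrow> sublist (w @ y) T"
proof -
  from assms obtain \<alpha> where "left_closure T w = \<alpha> @ w" "forced_left_extension T w \<alpha>"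
    by (rule left_closureE)
  then show ?thesis
    using forced_left_extension_sublist[of T w \<alpha> y] sublist_appendD2[of \<alpha> "w @ y" T] by auto
qed

lemma out_degree_left_closure:
  assumes "sublist w T"
  shows "out_degree T (left_closure T w) = out_degree T w"
  by (simp add: out_degree_def sublist_left_closure_append_iff[OF assms])

lemma left_closure_in_max_substrings:
  assumes "right_maximal T w"
  shows "left_closure T w \<in> max_substrings T"
proof -
  from assms have w: "sublist w T" by (simp add: right_maximal_def)
  then obtain \<alpha> where x: "left_closure T w = \<alpha> @ w" "forced_left_extension T w \<alpha>"
    "left_maximal T (left_closure T w)" by (rule left_closureE)
  have "right_maximal T (left_closure T w)"
    using assms x w forced_left_extension_suffix[OF x(2)] sublist_left_closure_append_iff[OF w]
    unfolding right_maximal_def left_maximal_def by auto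
  with x(3) show ?thesis by (simp add: max_substrings_def)
qed

lemma left_closure_inj_prefix:
  assumes w1: "sublist w1 T" and w2: "sublist w2 T" and pre: "prefix w1 w2"
    and eq: "left_closure T w1 = left_closure T w2"
  shows "w1 = w2"
proof (rule ccontr)
  assume "w1 \<noteq> w2"
  with pre obtain y where y: "w2 = w1 @ y" "y \<noteq> []" by (auto simp: prefix_def)
  from w1 obtain \<alpha>1 where \<alpha>1: "left_closure T w1 = \<alpha>1 @ w1" "forced_left_extension T w1 \<alpha>1"
    by (rule left_closureE)
  from w2 obtain \<alpha>2 where \<alpha>2: "left_closure T w2 = \<alpha>2 @ w2" by (rule left_closureE)
  from w1 obtain s0 t0 where "T = s0 @ w1 @ t0" by (auto simp: sublist_def)
  then have "\<exists>t. T = s0 @ w1 @ t" by blast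
  from ex_has_least_nat[where P = "\<lambda>s. \<exists>t. T = s @ w1 @ t" and m = length, OF this]
  obtain s where "\<exists>t. T = s @ w1 @ t"
    and leftmost: "\<And>s'. \<exists>t. T = s' @ w1 @ t \<Longrightarrow> length s \<le> length s'"
    by blast
  then obtain t where T: "T = s @ w1 @ t" by blast
  with \<alpha>1(2) obtain s' where s': "s = s' @ \<alpha>1" by (rule forced_left_extensionE)
  have same: "\<alpha>1 @ w1 = \<alpha>2 @ w2" using \<alpha>1 \<alpha>2 eq by simp
  \<comment> \<open>Rereading \<open>\<alpha>1 @ w1\<close> as \<open>\<alpha>2 @ w1 @ y\<close>
    yields an occurrence of \<open>w1\<close> at offset \<open>length \<alpha>2\<close> after
    \<open>s'\<close>. Leftmostness of \<open>s\<close> gives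
    \<open>length \<alpha>1 \<le> length \<alpha>2\<close>, but \<open>w2\<close> being longer than
    \<open>w1\<close> demands the strict opposite.\<close>
  with T s' have "T = (s' @ \<alpha>2) @ w1 @ (y @ t)"
    using y by (metis append.assoc)
  then have "length s \<le> length (s' @ \<alpha>2)" using leftmost by blast
  with s' have "length \<alpha>1 \<le> length \<alpha>2" by simp
  with arg_cong[OF same, of length] y show False by simp
qed

section \<open>Maximality and out-degree in special cases\<close>

lemma left_maximal_if_prefix: "prefix x T \<Longrightarrow> left_maximal T x"
  by (simp add: left_maximal_def)

lemma out_degree_Nil_right: "out_degree T [] = card (set T)"
proof -
  have "{c. sublist ([] @ [c]) T} = set T"
    by (auto simp: sublist_def in_set_conv_decomp)
  then show ?thesis by (simp add: out_degree_def)
qed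

lemma not_right_maximal_out_degree:
  assumes "\<not> right_maximal T x" "sublist x T"
  shows "out_degree T x \<le> 1"
  unfolding out_degree_def One_nat_def
  by (subst card_le_Suc0_iff_eq) (use assms in \<open>auto simp: right_maximal_def finite_right_extensions\<close>)

text \<open>\<open>T\<close> is a power of a single character, so each of its substrings is both a
  prefix and a suffix.\<close>

lemma unary_sublist_maximal:
  assumes "card (set T) \<le> 1" "sublist x T"
  shows "x \<in> max_substrings T"
proof -
  have "\<forall>x\<in>set T. \<forall>y\<in>set T. x = y"
    using assms(1) card_le_Suc0_iff_eq[of "set T"] by simp
  then obtain b where "set T \<subseteq> {b}" by blast
  then have all_b: "y = replicate (length y) b" if "set y \<subseteq> set T" for y
    using that by (intro replicate_length_same[symmetric]) blast
  from assms(2) obtain s t where st: "T = s @ x @ t" by (auto simp: sublist_def)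
  define m k where "m = length x" and "k = length s + length t"
  have x: "x = replicate m b" unfolding m_def by (rule all_b) (auto simp: st)
  have "length T = m + k" by (simp add: st m_def k_def)
  with all_b[of T] have T: "T = replicate (m + k) b" by simp
  have "T = x @ replicate k b" by (simp only: T x replicate_add)
  moreover have "T = replicate k b @ x" by (simp only: T x replicate_add[symmetric] add.commute)
  ultimately have "prefix x T" "suffix x T" unfolding prefix_def suffix_def by blast+
  with assms(2) show ?thesis
    by (simp add: max_substrings_def left_maximal_def right_maximal_def)
qed

text \<open>The first \<open>a\<close> in \<open>T\<close> either starts \<open>T\<close> or follows
  a character \<open>e \<noteq> a\<close>; in the latter case \<open>e\<close> and \<open>a\<close>
  are two distinct left extensions.\<close>

lemma left_maximal_singleton_if_square:
  assumes aa: "sublist [a, a] T"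
  shows "left_maximal T [a]"
proof -
  have a: "sublist [a] T" using sublist_appendD2[of "[a]" "[a]"] aa by simp
  then have "a \<in> set T" by (auto simp: sublist_def)
  then obtain s t where T: "T = s @ a # t" "a \<notin> set s" by (meson split_list_first)
  show ?thesis
  proof (cases s rule: rev_cases)
    case Nil
    with T show ?thesis by (simp add: left_maximal_if_prefix)
  next
    case (snoc s' e)
    with T have "e \<noteq> a" "sublist [e, a] T" by (auto simp: sublist_def)
    with a aa show ?thesis by (auto simp: left_maximal_def)
  qed
qed

section \<open>Nodes and out-degrees after prepending a character\<close>

locale left_insertion =
  fixes T :: "'a list" and a :: 'a and p :: "'a list"
  assumes p_prefix: "prefix p (a # T)"
    and p_sublist: "sublist p T"
    and p_longest: "prefix q (a # T) \<Longrightarrow> sublist q T \<Longrightarrow> prefix q p"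
begin

definition new_prefixes :: "'a list set" where
  "new_prefixes = {w. prefix w p \<and> right_maximal T w \<and> \<not> left_maximal T w}"

lemma new_prefixes_sublist: "w \<in> new_prefixes \<Longrightarrow> sublist w T"
  by (simp add: new_prefixes_def right_maximal_def)

lemma finite_new_prefixes: "finite new_prefixes"
  by (rule finite_subset[of _ "set (sublists T)"]) (auto dest: new_prefixes_sublist)

lemma sublist_Cons_iff: "sublist x (a # T) \<longleftrightarrow> sublist x T \<or> prefix x (a # T)"
  by (auto simp: sublist_Cons_right)

text \<open>A string that is new in \<open>a # T\<close> occurs there only as a prefix. So
  \<open>x\<close> is a prefix of \<open>p\<close> by the choice of \<open>p\<close>, whereas
  \<open>x @ [c]\<close> is too long to be one.\<close>

lemma new_right_extension:
  assumes "sublist x T" "sublist (x @ [c]) (a # T)" "\<not> sublist (x @ [c]) T"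
  shows "x = p"
proof -
  from assms have pre: "prefix (x @ [c]) (a # T)" by (simp add: sublist_Cons_iff)
  then have "prefix x (a # T)" by (meson append_prefixD)
  then have "prefix x p" using assms(1) by (rule p_longest)
  moreover have "\<not> prefix (x @ [c]) p"
    using assms(3) p_sublist sublist_order.order.trans[OF prefix_imp_sublist] by blast
  with pre p_prefix have "prefix p (x @ [c])" "p \<noteq> x @ [c]"
    using prefix_same_cases by blast+
  then have "prefix p x" by (simp add: prefix_snoc)
  ultimately show ?thesis by (simp add: prefix_order.antisym)
qed

lemma new_right_extension_unique:
  assumes "prefix (x @ [c]) (a # T)" "prefix (x @ [d]) (a # T)"
  shows "c = d"
  using assms by (auto simp: prefix_def)

lemma out_degree_Cons_le:
  assumes "sublist x T" "x \<noteq> p"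
  shows "out_degree (a # T) x \<le> out_degree T x"
  unfolding out_degree_def
  by (rule card_mono[OF finite_right_extensions]) (use new_right_extension assms in blast)

lemma out_degree_Cons_p_le: "out_degree (a # T) p \<le> Suc (out_degree T p)"
proof -
  \<comment> \<open>Only the character following \<open>p\<close> at the front of
    \<open>a # T\<close> can be a new extension, so \<open>D\<close> has at most one
    element.\<close>
  define D where "D = {c. prefix (p @ [c]) (a # T)}"
  have "finite D \<and> card D \<le> 1"
  proof -
    have "D \<subseteq> set (a # T)"
      unfolding D_def using set_mono_prefix by fastforce
    then have "finite D" by (rule finite_subset) simp
    then show ?thesis
      using card_le_Suc0_iff_eq[of D] new_right_extension_unique by (auto simp: D_def)
  qed
  moreover have "{c. sublist (p @ [c]) (a # T)} = {c. sublist (p @ [c]) T} \<union> D"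
    by (auto simp: sublist_Cons_iff D_def)
  ultimately show ?thesis
    unfolding out_degree_def using card_Un_le[of "{c. sublist (p @ [c]) T}" D] by simp
qed

lemma out_degree_whole: "out_degree (a # T) (a # T) = 0"
proof -
  have "{c. sublist ((a # T) @ [c]) (a # T)} = {}"
    by (auto dest!: sublist_length_le)
  then show ?thesis unfolding out_degree_def by (metis card.empty)
qed

lemma max_substrings_Cons_subset:
  "max_substrings (a # T) \<subseteq> insert (a # T) (insert p (max_substrings T \<union> new_prefixes))"
proof
  fix x assume "x \<in> max_substrings (a # T)"
  then have lm: "left_maximal (a # T) x" and rm: "right_maximal (a # T) x"
    by (auto simp: max_substrings_def)
  have "x \<in> max_substrings T \<union> new_prefixes" if ne: "x \<noteq> a # T" "x \<noteq> p"
  proof -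
    have suf: "suffix x T" if "suffix x (a # T)"
      using that ne by (auto simp: suffix_Cons)
    \<comment> \<open>Otherwise \<open>x\<close> occurs only at the front of \<open>a # T\<close>
      and has at most one right extension, so it must be a suffix; being different from
      \<open>a # T\<close>, it would then occur in \<open>T\<close>.\<close>
    have sub: "sublist x T"
    proof (rule ccontr)
      assume nsub: "\<not> sublist x T"
      then have "\<not> sublist (x @ [c]) T" for c
        using sublist_order.order.trans[OF prefix_imp_sublist, of x "x @ [c]" T] by auto
      then have "c = d" if "sublist (x @ [c]) (a # T)" "sublist (x @ [d]) (a # T)" for c d
        using that new_right_extension_unique by (auto simp: sublist_Cons_iff)
      with rm have "suffix x (a # T)" unfolding right_maximal_def by blast
      with suf nsub show False by blast
    qed
    have rmT: "right_maximal T x"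
      using rm suf sub new_right_extension[OF sub] ne(2) unfolding right_maximal_def by blast
    show ?thesis
    proof (cases "left_maximal T x")
      case True
      with rmT show ?thesis by (simp add: max_substrings_def)
    next
      case False
      \<comment> \<open>A left extension \<open>c # x\<close> that is new would be a prefix of
        \<open>a # T\<close>, making \<open>x\<close> a prefix of \<open>T\<close> and thus
        left-maximal in \<open>T\<close>. So two distinct left extensions would both lie in
        \<open>T\<close> already.\<close>
      have "prefix x (a # T)"
      proof (rule ccontr)
        assume "\<not> prefix x (a # T)"
        with lm obtain c d where "c \<noteq> d" "sublist (c # x) (a # T)" "sublist (d # x) (a # T)"
          unfolding left_maximal_def by blast
        with False sub show False by (auto simp: left_maximal_def sublist_Cons_iff)
      qed
      with False rmT p_longest[OF _ sub] show ?thesis by (simp add: new_prefixes_def)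
    qed
  qed
  then show "x \<in> insert (a # T) (insert p (max_substrings T \<union> new_prefixes))" by blast
qed

definition old_and_new_degrees :: nat where
  "old_and_new_degrees = cdawg_size T + (\<Sum>w\<in>new_prefixes. out_degree T w)"

lemma sum_old_and_new:
  "(\<Sum>x\<in>max_substrings T \<union> new_prefixes. out_degree T x) = old_and_new_degrees"
  unfolding old_and_new_degrees_def cdawg_size_def
  by (rule sum.union_disjoint[OF finite_max_substrings finite_new_prefixes])
     (auto simp: max_substrings_def new_prefixes_def)

text \<open>The node \<open>a # T\<close> has out-degree 0 and only \<open>p\<close> gains an edge.
  If \<open>p\<close> is not counted among the old nodes and new prefixes, it is not right-maximal
  in \<open>T\<close>; its old out-degree is then at most 1, giving at most 2 altogether.\<close>

lemma cdawg_size_Cons_le: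
  "cdawg_size (a # T) \<le>
     old_and_new_degrees + (if p \<in> max_substrings T \<union> new_prefixes then 1 else 2)"
proof -
  let ?S = "max_substrings T \<union> new_prefixes"
  have fin: "finite ?S" by (simp add: finite_max_substrings finite_new_prefixes)
  have sub: "sublist x T" if "x \<in> ?S" for x
    using that new_prefixes_sublist by (auto simp: max_substrings_def left_maximal_def)
  have "a # T \<notin> insert p ?S"
    using sub p_sublist sublist_length_le[of "a # T" T] by fastforce
  have "cdawg_size (a # T) \<le> (\<Sum>x\<in>insert (a # T) (insert p ?S). out_degree (a # T) x)"
    unfolding cdawg_size_def
    by (rule sum_mono2) (use fin max_substrings_Cons_subset in auto)
  also have "\<dots> = (\<Sum>x\<in>insert p ?S. out_degree (a # T) x)"
    using \<open>a # T \<notin> insert p ?S\<close> fin by (simp add: out_degree_whole)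
  also have "\<dots> = out_degree (a # T) p + (\<Sum>x\<in>?S - {p}. out_degree (a # T) x)"
    using fin by (rule sum.insert_remove)
  also have "\<dots> \<le> Suc (out_degree T p) + (\<Sum>x\<in>?S - {p}. out_degree T x)"
    by (intro add_mono out_degree_Cons_p_le sum_mono out_degree_Cons_le) (use sub in auto)
  also have "\<dots> \<le> (\<Sum>x\<in>?S. out_degree T x) + (if p \<in> ?S then 1 else 2)"
  proof (cases "p \<in> ?S")
    case True
    then show ?thesis using sum.remove[OF fin True, of "out_degree T"] by simp
  next
    case False
    then have "\<not> right_maximal T p" by (auto simp: max_substrings_def new_prefixes_def)
    then have "out_degree T p \<le> 1" using p_sublist by (rule not_right_maximal_out_degree)
    with False show ?thesis by simp
  qed
  finally show ?thesis by (simp only: sum_old_and_new)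
qed

section \<open>Charging the new prefixes to nodes of the old string\<close>

lemma inj_on_left_closure: "inj_on (left_closure T) new_prefixes"
proof (rule inj_onI)
  fix w1 w2
  assume w: "w1 \<in> new_prefixes" "w2 \<in> new_prefixes"
    and eq: "left_closure T w1 = left_closure T w2"
  then have "prefix w1 w2 \<or> prefix w2 w1"
    unfolding new_prefixes_def using prefix_same_cases by blast
  with w eq show "w1 = w2"
    using left_closure_inj_prefix new_prefixes_sublist by metis
qed

lemma left_closure_new_prefix_not_Nil:
  assumes "w \<in> new_prefixes"
  shows "left_closure T w \<noteq> []"
proof -
  from assms have "w \<noteq> []" by (auto simp: new_prefixes_def left_maximal_if_prefix)
  moreover obtain \<alpha> where "left_closure T w = \<alpha> @ w"
    using new_prefixes_sublist[OF assms] by (rule left_closureE)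
  ultimately show ?thesis by simp
qed

lemma Nil_in_max_substrings: "[] \<in> max_substrings T"
  by (simp add: max_substrings_def left_maximal_def right_maximal_def)

text \<open>The empty string, the closures of the new prefixes and \<open>V\<close> are disjoint
  families of nodes of \<open>T\<close>. The set \<open>V\<close> collects spare nodes: it is empty
  for the basic estimate and a singleton in the binary case.\<close>

lemma sum_new_prefixes_le:
  assumes V: "V \<subseteq> max_substrings T" "[] \<notin> V"
    and avoid: "V \<inter> left_closure T ` new_prefixes = {}"
  shows "(\<Sum>w\<in>new_prefixes. out_degree T w) + card (set T) + (\<Sum>v\<in>V. out_degree T v)
    \<le> cdawg_size T"
proof -
  let ?F = "left_closure T ` new_prefixes"
  have finV: "finite V" using V(1) finite_max_substrings by (rule finite_subset)
  have reindex: "(\<Sum>w\<in>new_prefixes. out_degree T w) = (\<Sum>x\<in>?F. out_degree T x)"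
    unfolding sum.reindex[OF inj_on_left_closure]
    by (rule sum.cong) (simp_all add: out_degree_left_closure new_prefixes_sublist)
  have "(\<Sum>x\<in>?F. out_degree T x) + (\<Sum>v\<in>V. out_degree T v) = (\<Sum>x\<in>?F \<union> V. out_degree T x)"
    by (rule sum.union_disjoint[symmetric]) (use finV finite_new_prefixes avoid in auto)
  moreover have "[] \<notin> ?F \<union> V" using V(2) left_closure_new_prefix_not_Nil by force
  then have "(\<Sum>x\<in>insert [] (?F \<union> V). out_degree T x)
      = card (set T) + (\<Sum>x\<in>?F \<union> V. out_degree T x)"
    using finV finite_new_prefixes by (subst sum.insert) (simp_all add: out_degree_Nil_right)
  ultimately have "(\<Sum>w\<in>new_prefixes. out_degree T w) + card (set T) + (\<Sum>v\<in>V. out_degree T v)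
      = (\<Sum>x\<in>insert [] (?F \<union> V). out_degree T x)"
    using reindex by simp
  also have "\<dots> \<le> cdawg_size T"
    unfolding cdawg_size_def
    by (rule sum_mono2[OF finite_max_substrings])
       (use V Nil_in_max_substrings left_closure_in_max_substrings in \<open>auto simp: new_prefixes_def\<close>)
  finally show ?thesis .
qed

section \<open>A spare node over a binary alphabet\<close>

lemma binary_slack:
  assumes p: "\<not> right_maximal T p" "p = a # u" "u \<noteq> []" and binary: "card (set T) = 2"
  shows "\<exists>v \<in> max_substrings T. v \<noteq> [] \<and> v \<notin> left_closure T ` new_prefixes
    \<and> out_degree T v \<ge> 2"
proof -
  have u_prefix: "prefix u T" using p_prefix p(2) by simp
  from p_sublist obtain s t where st: "T = s @ p @ t" by (auto simp: sublist_def)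
  have "t \<noteq> []"
    using p(1) p_sublist st by (auto simp: right_maximal_def suffix_def)
  then obtain d where d: "sublist (p @ [d]) T"
    using st by (cases t) (auto simp: sublist_def)
  have "length p \<le> length T" using p_sublist by (rule sublist_length_le)
  with p_prefix obtain c r where c: "a # T = p @ c # r"
    by (auto simp: prefix_def) (metis append_Nil2 length_Cons neq_Nil_conv not_less_eq_eq order_refl)
  \<comment> \<open>\<open>c\<close> follows \<open>p\<close> at the front of \<open>a # T\<close>,
    \<open>d\<close> follows it inside \<open>T\<close>; equality would make \<open>p @ [c]\<close>
    a longer candidate than \<open>p\<close>.\<close>
  have "c \<noteq> d"
  proof
    assume "c = d"
    with c d have "prefix (p @ [c]) p" by (intro p_longest) auto
    then show False by (auto dest: prefix_length_le)
  qed
  have uc: "sublist (u @ [c]) T" using c p(2) by (auto simp: sublist_def)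
  have ud: "sublist (u @ [d]) T" using d p(2) sublist_appendD2[of "[a]" "u @ [d]"] by simp
  \<comment> \<open>As a prefix of \<open>u\<close>, a border is a prefix of \<open>T\<close>; as a
    suffix of \<open>u\<close>, it inherits both right extensions \<open>c\<close> and
    \<open>d\<close>.\<close>
  let ?B = "\<lambda>v. v \<noteq> [] \<and> prefix v u \<and> suffix v u"
  have "?B u" using p(3) by simp
  from ex_has_least_nat[where P = ?B and m = length, OF this] obtain v where v: "?B v" and shortest: "\<And>v'. ?B v' \<Longrightarrow> length v \<le> length v'"
    by blast
  have ext: "sublist (y @ [c]) T" "sublist (y @ [d]) T" if "suffix y u" for y
    using that uc ud sublist_appendD2 by (fastforce simp: suffix_def)+
  have v_prefix: "prefix v T" using v u_prefix prefix_order.trans by blast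
  then have "left_maximal T v" by (rule left_maximal_if_prefix)
  moreover have "right_maximal T v"
    using v_prefix \<open>c \<noteq> d\<close> ext v by (auto simp: right_maximal_def)
  ultimately have "v \<in> max_substrings T" by (simp add: max_substrings_def)
  moreover have "out_degree T v \<ge> 2"
  proof -
    have "card {c, d} \<le> out_degree T v"
      unfolding out_degree_def
      by (rule card_mono[OF finite_right_extensions]) (use ext v in auto)
    with \<open>c \<noteq> d\<close> show ?thesis by simp
  qed
  moreover have "v \<notin> left_closure T ` new_prefixes"
  proof
    assume "v \<in> left_closure T ` new_prefixes"
    then obtain w where w: "w \<in> new_prefixes" "v = left_closure T w" by blast
    from new_prefixes_sublist[OF w(1)] obtain \<alpha> where "v = \<alpha> @ w"
      by (rule left_closureE) (use w in simp)
    then have w_suffix: "suffix w v" by (simp add: suffix_def)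
    have wN: "prefix w p" "right_maximal T w" "\<not> left_maximal T w"
      using w by (auto simp: new_prefixes_def)
    then have "w \<noteq> []" by (auto simp: left_maximal_if_prefix)
    with wN(1) p(2) obtain w1 where w1: "w = a # w1" "prefix w1 u"
      by (cases w) auto
    have "suffix w1 u"
      using w1(1) w_suffix v suffix_order.trans by (metis suffix_ConsI suffix_order.refl)
    moreover have "length w1 < length v"
      using w1(1) suffix_length_le[OF w_suffix] by simp
    \<comment> \<open>\<open>w1\<close> is a border of \<open>u\<close> shorter than the shortest
      nonempty one.\<close>
    ultimately have "w1 = []" using shortest[of w1] w1(2) by fastforce
    then have wa: "w = [a]" using w1 by simp
    have "suffix [a] u" using w_suffix v wa suffix_order.trans by blast
    from ext[OF this] have ac: "sublist [a, c] T" "sublist [a, d] T" by simp_all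
    have "set [a, c] \<subseteq> set T" "set [a, d] \<subseteq> set T" using ac by (auto dest: set_mono_sublist)
    then have "{a, c, d} \<subseteq> set T" by simp
    then have "card {a, c, d} \<le> 2" using binary card_mono[of "set T"] by fastforce
    \<comment> \<open>With only two characters available, one of \<open>[a, c]\<close> and
      \<open>[a, d]\<close> is the square \<open>[a, a]\<close>, which makes \<open>[a]\<close>
      left-maximal and hence not a new prefix.\<close>
    then have "a = c \<or> a = d" using \<open>c \<noteq> d\<close> by (auto simp: card_insert_if split: if_splits)
    with ac have "sublist [a, a] T" by auto
    then have "left_maximal T [a]" by (rule left_maximal_singleton_if_square)
    with wN(3) wa show False by simp
  qed
  ultimately show ?thesis using v by blast
qed

section \<open>Case analysis on the alphabet size and the final bound\<close>

lemma cdawg_size_Cons_bound_aux: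
  assumes "cdawg_size T \<ge> 3"
  shows "cdawg_size (a # T) + 1 \<le> 2 * cdawg_size T"
proof -
  have base: "(\<Sum>w\<in>new_prefixes. out_degree T w) + card (set T) \<le> cdawg_size T"
    using sum_new_prefixes_le[of "{}"] by simp
  note bound = cdawg_size_Cons_le[unfolded old_and_new_degrees_def]
  have p_cases: "p = [] \<or> (\<exists>u. p = a # u)"
    using p_prefix by (cases p) auto
  have "card (set T) \<le> 1 \<or> card (set T) = 2 \<or> card (set T) \<ge> 3" by linarith
  with p_cases consider "card (set T) \<le> 1" | "card (set T) \<ge> 2" "right_maximal T p"
    | "\<not> right_maximal T p" "p = []" | "card (set T) \<ge> 3"
    | u where "card (set T) = 2" "\<not> right_maximal T p" "p = a # u"
    by fastforce
  then show ?thesis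
  proof cases
    case 1
    have "w \<notin> new_prefixes" for w
    proof
      assume w: "w \<in> new_prefixes"
      have "w \<in> max_substrings T" by (rule unary_sublist_maximal[OF 1 new_prefixes_sublist[OF w]])
      with w show False unfolding new_prefixes_def max_substrings_def by blast
    qed
    then have "new_prefixes = {}" by blast
    moreover have "p \<in> max_substrings T" using unary_sublist_maximal[OF 1 p_sublist] .
    ultimately show ?thesis using bound assms by simp
  next
    case 2
    then have "p \<in> max_substrings T \<union> new_prefixes"
      by (auto simp: max_substrings_def new_prefixes_def)
    with bound base 2 show ?thesis by simp
  next
    case 3
    \<comment> \<open>This case is void: the empty string is always right-maximal.\<close>
    then show ?thesis using Nil_in_max_substrings by (simp add: max_substrings_def)
  next
    case 4
    with bound base show ?thesis by (simp split: if_splits)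
  next
    case (5 u)
    show ?thesis
    proof (cases "u = []")
      case True
      have "w \<notin> new_prefixes" for w
      proof
        assume "w \<in> new_prefixes"
        then have w: "prefix w p" "right_maximal T w" "\<not> left_maximal T w"
          unfolding new_prefixes_def by blast+
        then have "w = [] \<or> w = p" using 5(3) True by (auto simp: prefix_Cons)
        with w 5(2) show False using left_maximal_if_prefix[of "[]" T] by auto
      qed
      then have "new_prefixes = {}" by blast
      \<comment> \<open>Here the bound is \<open>cdawg_size T + 2\<close>, so the assumption
        \<open>cdawg_size T \<ge> 3\<close> is exactly what closes the gap.\<close>
      with bound assms show ?thesis by (simp split: if_splits)
    next
      case False
      with binary_slack[of u] 5 obtain v where v: "v \<in> max_substrings T" "v \<noteq> []"
        "v \<notin> left_closure T ` new_prefixes" "out_degree T v \<ge> 2" by blast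
      have "(\<Sum>w\<in>new_prefixes. out_degree T w) + card (set T) + out_degree T v \<le> cdawg_size T"
        using sum_new_prefixes_le[of "{v}"] v by simp
      \<comment> \<open>The empty string and \<open>v\<close> save at least 2 each, which more than
        absorbs the additive 2.\<close>
      with bound v(4) 5 show ?thesis by (simp split: if_splits)
    qed
  qed
qed

end

lemma cdawg_size_Cons_bound:
  assumes "cdawg_size T \<ge> 3"
  shows "cdawg_size (a # T) + 1 \<le> 2 * cdawg_size T"
proof -
  let ?P = "\<lambda>q. prefix q (a # T) \<and> sublist q T"
  have "\<exists>p. ?P p \<and> (\<forall>q. ?P q \<longrightarrow> length q \<le> length p)"
    by (rule ex_has_greatest_nat[where k = "[]" and b = "Suc (length T)"])
       (auto simp: less_Suc_eq_le dest: sublist_length_le)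
  then obtain p where p: "?P p" and longest: "\<And>q. ?P q \<Longrightarrow> length q \<le> length p"
    by blast
  interpret left_insertion T a p
  proof
    \<comment> \<open>Prefixes of one string are comparable, so maximal length yields maximality in
      the prefix order.\<close>
    show "prefix q p" if "prefix q (a # T)" "sublist q T" for q
      using that p longest[of q] by (auto intro: prefix_length_prefix)
  qed (use p in auto)
  from assms show ?thesis by (rule cdawg_size_Cons_bound_aux)
qed

theorem theorem1:
  fixes \<Sigma> :: "'a set"
  shows "(\<forall>T \<in> lists \<Sigma>. \<forall>a \<in> \<Sigma>. length T \<ge> 3 \<longrightarrow> cdawg_size T \<ge> 3 \<longrightarrow>
            int (cdawg_size (a # T)) - int (cdawg_size T) \<le> int (cdawg_size T) - 1)
       \<and> (\<forall>n e :: nat. n \<ge> 3 \<longrightarrow> e \<ge> 3 \<longrightarrow>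
            left_insertion_sensitivity \<Sigma> n e \<le> ereal (real e - 1))"
proof (intro conjI ballI allI impI)
  fix T :: "'a list" and a assume "cdawg_size T \<ge> 3"
  from cdawg_size_Cons_bound[OF this, of a]
  show "int (cdawg_size (a # T)) - int (cdawg_size T) \<le> int (cdawg_size T) - 1" by linarith
next
  fix n e :: nat assume e: "e \<ge> 3"
  have "real (cdawg_size (a # T)) - real e \<le> real e - 1" if "cdawg_size T = e" for T :: "'a list" and a
    using cdawg_size_Cons_bound[of T a] that e by linarith
  then show "left_insertion_sensitivity \<Sigma> n e \<le> ereal (real e - 1)"
    \<comment> \<open>Bounding each member also covers an empty index set, where the supremum is
      \<open>- \<infinity>\<close>.\<close>
    unfolding left_insertion_sensitivity_def by (intro SUP_least) auto
qed

end
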